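(* Let $n$ be large and let $B\ge\log n$ be an integer space parameter. Consider a stream whose final frequency vector is the Zipfian vector $f\in\mathbb{R}^n$ with $f_i=1/i$, and suppose we have a heavy-hitter oracle that correctly identifies the top $B/2$ heavy hitters, i.e., for every $i\in[n]$ it correctly reports whether $i\le B/2$. Consider the following algorithm. Let $T=\Theta(\log\log n)$. It maintains independent CountSketch tables $S_1,\dots,S_{T-1}$, each with $3$ rows and $\frac{B}{12T}$ columns, and $S_T$ with $3$ rows and $\frac{B}{12}$ columns. For each stream update $(i,\Delta)$: if $i$ is a top $B/2$ heavy hitter, its frequency is maintained exactly (in separate storage); otherwise $(i,\Delta)$ is fed into all $T$ tables. To answer a query for $i$: if $i$ is a top $B/2$ heavy hitter, output its exactly maintained frequency; otherwise let $\hat f_i^{\,j}$ be the CountSketch estimate from table $S_j$, let $\tilde f_i=\mathrm{Median}(\hat f_i^{\,1},\dots,\hat f_i^{\,T-1})$, and output $\hat f_i=0$ if $\tilde f_i<\tau$ where $\tau=\Theta(\log\log n)/B$, and $\hat f_i=\hat f_i^{\,T}$ otherwise. Then, for suitable choices of the absolute constants hidden in $T$ and $\tau$, the expected weighted error satisfies $$\mathbb{E}\left[\frac{1}{N}\sum_{i=1}^n f_i\,|f_i-\hat f_i|\right]=O\left(\frac{1}{B\log n}\right),$$ where $N=\sum_{i=1}^n f_i$.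
   Context: A stream consists of updates $(i,\Delta)$ with $i\in[n]$, $\Delta\in\mathbb{R}$; the final frequency vector $f$ has $f_i$ equal to the sum of the updates to coordinate $i$. A CountSketch table with $k$ rows and $w$ columns uses independent, uniformly random hash functions $h_1,\dots,h_k:[n]\to[w]$ and signs $s_1,\dots,s_k:[n]\to\{-1,1\}$, maintains $C[\ell,b]=\sum_{j}[h_\ell(j)=b]\,s_\ell(j)g_j$ where $g$ is the vector of updates fed to the table, and estimates coordinate $i$ by $\mathrm{median}_{\ell\in[k]}\,s_\ell(i)\,C[\ell,h_\ell(i)]$. The expectation is over the randomness of the tables. *)

theory Defs
  imports "HOL-Probability.Probability"
begin

type_synonym stream = "(nat \<times> real) list"

definition frequency :: "stream \<Rightarrow> nat \<Rightarrow> real" where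
  "frequency \<sigma> i = (\<Sum>(j, \<Delta>)\<leftarrow>\<sigma>. if j = i then \<Delta> else 0)"

text \<open>For lists of even length this is the mean of the two middle entries.\<close>
definition median :: "real list \<Rightarrow> real" where
  "median xs = (let ys = sort xs; m = length xs div 2 in
     if odd (length xs) then ys ! m else (ys ! (m - 1) + ys ! m) / 2)"

text \<open>The randomness of a table assigns to each row its hash function and its sign function.
  Coordinates, rows and columns are all numbered from 1.\<close>
type_synonym table_seed = "nat \<Rightarrow> (nat \<Rightarrow> nat) \<times> (nat \<Rightarrow> real)"

text \<open>The set of hash functions must be nonempty for the uniform distribution to be
  meaningful, so this is intended for \<open>w \<ge> 1\<close> only.\<close>
definition table_seed_pmf :: "nat \<Rightarrow> nat \<Rightarrow> nat \<Rightarrow> table_seed pmf" where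
  "table_seed_pmf n k w = Pi_pmf {1..k} undefined
     (\<lambda>_. pair_pmf (pmf_of_set ({1..n} \<rightarrow>\<^sub>E {1..w})) (pmf_of_set ({1..n} \<rightarrow>\<^sub>E {-1, 1})))"

definition cs_counter :: "nat \<Rightarrow> table_seed \<Rightarrow> (nat \<Rightarrow> real) \<Rightarrow> nat \<Rightarrow> nat \<Rightarrow> real" where
  "cs_counter n S g l b =
     (\<Sum>j=1..n. of_bool (fst (S l) j = b) * snd (S l) j * g j)"

definition cs_estimate :: "nat \<Rightarrow> nat \<Rightarrow> table_seed \<Rightarrow> (nat \<Rightarrow> real) \<Rightarrow> nat \<Rightarrow> real" where
  "cs_estimate n k S g i =
     median (map (\<lambda>l. snd (S l) i * cs_counter n S g l (fst (S l) i)) [1..<k + 1])"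

text \<open>Table \<open>T\<close> is the wide one; fractional column counts are rounded down.\<close>
definition algorithm_seed_pmf :: "nat \<Rightarrow> nat \<Rightarrow> nat \<Rightarrow> (nat \<Rightarrow> table_seed) pmf" where
  "algorithm_seed_pmf n B T = Pi_pmf {1..T} undefined
     (\<lambda>j. table_seed_pmf n 3 (if j = T then B div 12 else B div (12 * T)))"

definition algorithm_estimate ::
    "nat \<Rightarrow> nat \<Rightarrow> real \<Rightarrow> (nat \<Rightarrow> bool) \<Rightarrow> stream \<Rightarrow> (nat \<Rightarrow> table_seed) \<Rightarrow> nat \<Rightarrow> real" where
  "algorithm_estimate n T \<tau> heavy \<sigma> S i =
     (if heavy i then frequency (filter (\<lambda>(j, \<Delta>). heavy j) \<sigma>) i
      else
        let g = frequency (filter (\<lambda>(j, \<Delta>). \<not> heavy j) \<sigma>);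
            est = (\<lambda>j. cs_estimate n 3 (S j) g i)
        in if median (map est [1..<T]) < \<tau> then 0 else est T)"

definition weighted_error :: "nat \<Rightarrow> (nat \<Rightarrow> real) \<Rightarrow> (nat \<Rightarrow> real) \<Rightarrow> real" where
  "weighted_error n f f' = 1 / (\<Sum>i=1..n. f i) * (\<Sum>i=1..n. f i * \<bar>f i - f' i\<bar>)"

end

theory Submission
  imports Defs "HOL-Real_Asymp.Real_Asymp"
begin

text \<open>For a light coordinate \<open>i\<close> the error is at most \<open>f\<^sub>i\<close> plus the error of the wide table \<open>T\<close>,
  the latter only when the median of the narrow tables reaches \<open>\<tau>\<close>. The terms \<open>f\<^sub>i\<^sup>2\<close> sum to
  \<open>O(1/B)\<close>. The noise of a row of width \<open>w\<close> has second moment at most \<open>(\<Sum>\<^sub>j g\<^sub>j\<^sup>2) / w\<close>, so the wide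
  table has expected error \<open>O(1/B)\<close>, and by Chebyshev a narrow one reaches \<open>\<tau>\<close> with probability
  \<open>O(1 / log log n)\<close>. If the median of \<open>T - 1\<close> estimates reaches \<open>\<tau>\<close>, so do half of them, hence
  the indicator of that event is at most \<open>4 ^ -(T - 1)\<close> times the product over \<open>j < T\<close> of 16 or 1,
  according to whether table \<open>j\<close> reaches \<open>\<tau>\<close> or not; each factor has expectation at most 2.
  As the tables are independent, the wide table contributes only a fraction
  \<open>2 ^ -(T - 1) = O(1 / log n)\<close> of its expected error.\<close>

section \<open>Restricted streams and medians\<close>

lemma frequency_filter:
  "frequency (filter (\<lambda>(j, \<Delta>). P j) \<sigma>) i = (if P i then frequency \<sigma> i else 0)"
  by (induction \<sigma>) (auto simp: frequency_def)

lemma median_in_set: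
  assumes "odd (length xs)"
  shows "median xs \<in> set xs"
proof -
  have "length xs div 2 < length (sort xs)"
    using assms by (cases xs) auto
  then show ?thesis
    using assms nth_mem[of "length xs div 2" "sort xs"] by (simp add: median_def Let_def)
qed

text \<open>The upper middle entry of the sorted list is at least the median: for odd length it is
  the median, for even length the median is its mean with a smaller or equal entry. So it and
  everything sorted after it reach \<open>t\<close>, which is at least half of the list.\<close>

lemma median_ge_imp_length_filter:
  assumes "xs \<noteq> []" "t \<le> median xs"
  shows "length xs \<le> 2 * length (filter (\<lambda>x. t \<le> x) xs)"
proof -
  define ys where "ys = sort xs"
  define m where "m = length xs div 2"
  have len: "length ys = length xs"
    by (simp add: ys_def)
  have m: "m < length ys"
    using assms(1) by (cases xs) (auto simp: m_def ys_def)
  have mid: "t \<le> ys ! m"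
  proof (cases "odd (length xs)")
    case True
    then show ?thesis using assms(2) by (simp add: median_def Let_def ys_def m_def)
  next
    case False
    have "ys ! (m - 1) \<le> ys ! m"
      by (rule sorted_nth_mono) (use m in \<open>auto simp: ys_def\<close>)
    with False show ?thesis
      using assms(2) by (simp add: median_def Let_def ys_def[symmetric] m_def[symmetric])
  qed
  have "t \<le> x" if x: "x \<in> set (drop m ys)" for x
  proof -
    obtain k where "k < length (drop m ys)" "x = drop m ys ! k"
      using x by (metis in_set_conv_nth)
    then have k: "k < length ys - m" "x = ys ! (m + k)"
      using m by auto
    have "ys ! m \<le> ys ! (m + k)"
      by (rule sorted_nth_mono) (use k in \<open>auto simp: ys_def\<close>)
    then show ?thesis using mid k by simp
  qed
  then have "filter (\<lambda>x. t \<le> x) (drop m ys) = drop m ys"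
    by (simp add: filter_id_conv)
  moreover have "length (filter (\<lambda>x. t \<le> x) ys) =
      length (filter (\<lambda>x. t \<le> x) (take m ys)) + length (filter (\<lambda>x. t \<le> x) (drop m ys))"
    by (metis append_take_drop_id filter_append length_append)
  moreover have "length (filter (\<lambda>x. t \<le> x) ys) = length (filter (\<lambda>x. t \<le> x) xs)"
    unfolding ys_def by (metis filter_sort length_sort)
  ultimately show ?thesis
    using len by (simp add: m_def)
qed

text \<open>If the median reaches \<open>t\<close>, at least half of the factors are 16 = 4^2, so
  their product is at least \<open>4 ^ length js\<close>; otherwise the left side is 0. A product
  with one factor per table is what independence can evaluate.\<close>

lemma of_bool_median_le_prod:
  fixes x :: "'a::linorder \<Rightarrow> real"
  assumes "distinct js" "js \<noteq> []"
  shows "of_bool (t \<le> median (map x js)) \<le>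
    (1/4) ^ length js * (\<Prod>j\<in>set js. if t \<le> x j then 16 else (1::real))"
proof (cases "t \<le> median (map x js)")
  case True
  define c where "c = card {j \<in> set js. t \<le> x j}"
  have "length (filter (\<lambda>y. t \<le> y) (map x js)) = c"
    using assms(1) by (simp add: filter_map o_def distinct_length_filter c_def Int_def conj_commute)
  with True assms have "length js \<le> 2 * c"
    using median_ge_imp_length_filter[of "map x js" t] by simp
  then have "(4::real) ^ length js \<le> 4 ^ (2 * c)"
    by (intro power_increasing) auto
  also have "\<dots> = (\<Prod>j\<in>set js. if t \<le> x j then 16 else 1)"
    by (simp add: power_mult c_def flip: prod.inter_filter)
  finally show ?thesis
    using True by (simp add: field_simps)
qed (simp add: prod_nonneg)

lemma median_ge_imp_ex:
  assumes "xs \<noteq> []" "t \<le> median xs"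
  shows "\<exists>x\<in>set xs. t \<le> x"
proof (rule ccontr)
  assume "\<not> ?thesis"
  then have "filter (\<lambda>x. t \<le> x) xs = []"
    by (auto simp: filter_empty_conv)
  with median_ge_imp_length_filter[OF assms] assms(1) show False
    by simp
qed

section \<open>Finite product distributions, random signs and collisions\<close>

text \<open>On a finite support every real function is integrable, which settles the integrability
  conditions of all expectations below.\<close>

lemma finite_set_Pi_pmf:
  assumes "finite A" "\<And>x. x \<in> A \<Longrightarrow> finite (set_pmf (p x))"
  shows "finite (set_pmf (Pi_pmf A d p))"
  using assms by (auto simp: set_Pi_pmf)

text \<open>Independence in product form; it will separate the hash function of a row from its
  signs.\<close>

lemma expectation_pair_pmf_mult:
  fixes f :: "'a \<Rightarrow> real" and g :: "'b \<Rightarrow> real"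
  assumes "finite (set_pmf p)" "finite (set_pmf q)"
  shows "measure_pmf.expectation (pair_pmf p q) (\<lambda>x. f (fst x) * g (snd x)) =
    measure_pmf.expectation p f * measure_pmf.expectation q g"
proof -
  have "measure_pmf.expectation (pair_pmf p q) (\<lambda>x. f (fst x) * g (snd x)) =
      (\<Sum>(a, b)\<in>set_pmf p \<times> set_pmf q. (pmf p a * f a) * (pmf q b * g b))"
    by (subst integral_measure_pmf[of "set_pmf p \<times> set_pmf q"])
      (use assms in \<open>auto simp: pmf_pair intro!: sum.cong\<close>)
  also have "\<dots> = (\<Sum>a\<in>set_pmf p. pmf p a * f a) * (\<Sum>b\<in>set_pmf q. pmf q b * g b)"
    by (simp add: sum_product sum.cartesian_product)
  also have "\<dots> = measure_pmf.expectation p f * measure_pmf.expectation q g"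
    by (simp add: integral_measure_pmf[OF assms(1)] integral_measure_pmf[OF assms(2)])
  finally show ?thesis .
qed

lemma expectation_sign_mult:
  fixes j k :: 'a
  assumes "finite A" "j \<in> A" "k \<in> A"
  shows "measure_pmf.expectation (pmf_of_set (A \<rightarrow>\<^sub>E {-1, 1})) (\<lambda>s. s j * s k) =
    (of_bool (j = k) :: real)"
proof -
  let ?S = "A \<rightarrow>\<^sub>E {-1, 1::real}"
  have fin: "finite ?S" "?S \<noteq> {}"
    using assms(1) by (auto simp: finite_PiE PiE_eq_empty_iff)
  have "(\<Sum>s\<in>?S. s j * s k) = of_bool (j = k) * card ?S"
  proof (cases "j = k")
    case True
    have "s j * s k = 1" if "s \<in> ?S" for s
      using that assms True by (auto dest!: PiE_mem[of _ _ _ k])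
    then show ?thesis using True by (simp cong: sum.cong)
  next
    case False
    \<comment> \<open>Flipping the sign of \<open>j\<close> is an involution that negates every term.\<close>
    have "(\<Sum>s\<in>?S. s j * s k) = (\<Sum>s\<in>?S. - (s j * s k))"
      by (rule sum.reindex_bij_witness[of _ "\<lambda>s. s(j := - s j)" "\<lambda>s. s(j := - s j)"])
        (use assms False in \<open>auto simp: PiE_iff extensional_def\<close>)
    then show ?thesis using False by (simp add: sum_negf)
  qed
  moreover have "card ?S \<noteq> 0"
    using fin by simp
  ultimately show ?thesis
    using fin by (simp add: integral_pmf_of_set)
qed

lemma expectation_collision_le:
  assumes "finite A" "i \<in> A" "j \<in> A" "i \<noteq> j" "w \<ge> 1"
  shows "measure_pmf.expectation (pmf_of_set (A \<rightarrow>\<^sub>E {1..w})) (\<lambda>h. of_bool (h j = h i)) \<le> 1 / real w"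
proof -
  let ?H = "A \<rightarrow>\<^sub>E {1..w}"
  have fin: "finite ?H" "?H \<noteq> {}"
    using assms by (auto simp: finite_PiE PiE_eq_empty_iff)
  \<comment> \<open>Rehashing \<open>j\<close> to an arbitrary column loses no information, as \<open>h j = h i\<close> can be restored.\<close>
  have "card ({h \<in> ?H. h j = h i} \<times> {1..w}) \<le> card ?H"
  proof (rule card_inj_on_le[OF _ _ fin(1)])
    show "inj_on (\<lambda>(h, b). h(j := b)) ({h \<in> ?H. h j = h i} \<times> {1..w})"
    proof (rule inj_onI, clarify)
      fix h b h' b'
      assume *: "h j = h i" "h' j = h' i" "h(j := b) = h'(j := b')"
      then have off: "h x = h' x" if "x \<noteq> j" for x
        using that *(3) by (metis fun_upd_other)
      have "h x = h' x" for x
        using *(1,2) off[of x] off[OF assms(4)] by (cases "x = j") auto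
      moreover have "b = b'"
        using fun_cong[OF *(3), of j] by simp
      ultimately show "h = h' \<and> b = b'"
        by auto
    qed
  qed (use assms in \<open>auto simp: PiE_iff extensional_def\<close>)
  moreover have "(\<Sum>h\<in>?H. of_bool (h j = h i)) = real (card {h \<in> ?H. h j = h i})"
    using fin(1) by (simp add: Int_def)
  ultimately have "(\<Sum>h\<in>?H. of_bool (h j = h i)) * real w \<le> real (card ?H)"
    by (simp add: card_cartesian_product flip: of_nat_mult)
  then show ?thesis
    using fin assms(5) by (simp add: integral_pmf_of_set card_gt_0_iff field_simps)
qed

section \<open>The noise of a single row\<close>

abbreviation row_pmf :: "nat \<Rightarrow> nat \<Rightarrow> ((nat \<Rightarrow> nat) \<times> (nat \<Rightarrow> real)) pmf" where
  "row_pmf n w \<equiv> pair_pmf (pmf_of_set ({1..n} \<rightarrow>\<^sub>E {1..w})) (pmf_of_set ({1..n} \<rightarrow>\<^sub>E {-1, 1}))"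

lemma set_pmf_of_funcset [simp]:
  assumes "finite A" "finite W" "W \<noteq> {}"
  shows "set_pmf (pmf_of_set (A \<rightarrow>\<^sub>E W)) = A \<rightarrow>\<^sub>E W"
  by (rule set_pmf_of_set) (use assms in \<open>auto simp: finite_PiE PiE_eq_empty_iff\<close>)

lemma finite_row_pmf: "w \<ge> 1 \<Longrightarrow> finite (set_pmf (row_pmf n w))"
  by (simp add: finite_PiE)

lemma finite_table_seed_pmf: "w \<ge> 1 \<Longrightarrow> finite (set_pmf (table_seed_pmf n k w))"
  unfolding table_seed_pmf_def by (rule finite_set_Pi_pmf) (simp_all add: finite_PiE)

text \<open>A function of the randomness of one row only, so that its moments can be computed in
  \<open>row_pmf\<close>; \<open>cs_estimate\<close> is the median of these values.\<close>

definition row_estimate :: "nat \<Rightarrow> (nat \<Rightarrow> real) \<Rightarrow> nat \<Rightarrow> (nat \<Rightarrow> nat) \<times> (nat \<Rightarrow> real) \<Rightarrow> real" where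
  "row_estimate n g i r = snd r i * (\<Sum>j=1..n. of_bool (fst r j = fst r i) * snd r j * g j)"

text \<open>The error of a row is a signed sum over the other coordinates in the column of
  \<open>i\<close>. Distinct signs are uncorrelated, so only the diagonal terms of the square
  survive, each weighted by a collision probability of at most \<open>1 / w\<close>.\<close>

lemma row_estimate_second_moment:
  assumes "w \<ge> 1" and i: "i \<in> {1..n}"
  shows "measure_pmf.expectation (row_pmf n w) (\<lambda>r. (row_estimate n g i r - g i)\<^sup>2)
    \<le> (\<Sum>j=1..n. (g j)\<^sup>2) / real w"
proof -
  let ?A = "{1..n} - {i}"
  let ?c = "\<lambda>j h. of_bool (h j = h i) :: real"
  let ?H = "pmf_of_set ({1..n} \<rightarrow>\<^sub>E {1..w})" and ?S = "pmf_of_set ({1..n} \<rightarrow>\<^sub>E {-1, 1::real})"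
  have fin: "finite (set_pmf ?H)" "finite (set_pmf ?S)"
    using assms by (simp_all add: finite_PiE)
  \<comment> \<open>On the support the sign of \<open>i\<close> squares to 1. Hence the summand
    \<open>j = i\<close> contributes exactly \<open>g i\<close>, and the outer sign disappears on
    squaring.\<close>
  have expand: "(row_estimate n g i r - g i)\<^sup>2 =
      (\<Sum>j\<in>?A. \<Sum>k\<in>?A. g j * g k * ((?c j (fst r) * ?c k (fst r)) * (snd r j * snd r k)))"
    if r: "r \<in> set_pmf (row_pmf n w)" for r
  proof -
    have sgn: "snd r i * snd r i = 1"
      using r i by (auto dest!: PiE_mem[of _ _ _ i])
    have "row_estimate n g i r = snd r i * (snd r i * g i) + snd r i * (\<Sum>j\<in>?A. ?c j (fst r) * snd r j * g j)"
      unfolding row_estimate_def using i by (subst sum.remove[of _ i]) (auto simp: algebra_simps)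
    also have "snd r i * (snd r i * g i) = g i"
      using sgn by (simp flip: mult.assoc)
    finally have "(row_estimate n g i r - g i)\<^sup>2 =
        (snd r i * snd r i) * ((\<Sum>j\<in>?A. ?c j (fst r) * snd r j * g j) * (\<Sum>j\<in>?A. ?c j (fst r) * snd r j * g j))"
      by (simp add: power2_eq_square algebra_simps)
    then show ?thesis
      unfolding sgn sum_product by (simp add: algebra_simps)
  qed
  have "measure_pmf.expectation (row_pmf n w) (\<lambda>r. (row_estimate n g i r - g i)\<^sup>2) =
      measure_pmf.expectation (row_pmf n w) (\<lambda>r. \<Sum>j\<in>?A. \<Sum>k\<in>?A.
        g j * g k * ((?c j (fst r) * ?c k (fst r)) * (snd r j * snd r k)))"
    by (intro integral_cong_AE) (auto simp: AE_measure_pmf_iff expand simp del: set_pair_pmf)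
  \<comment> \<open>Linearity over both sums, then independence of hash and signs.\<close>
  also have "\<dots> = (\<Sum>j\<in>?A. \<Sum>k\<in>?A. g j * g k * (measure_pmf.expectation ?H (\<lambda>h. ?c j h * ?c k h)
        * measure_pmf.expectation ?S (\<lambda>s. s j * s k)))"
    by (subst Bochner_Integration.integral_sum,
        (intro integrable_measure_pmf_finite finite_row_pmf assms)[1], rule sum.cong[OF refl])+
      (simp add: expectation_pair_pmf_mult[OF fin, of "\<lambda>h. ?c _ h * ?c _ h" "\<lambda>s. s _ * s _"] del: One_nat_def)
  also have "\<dots> = (\<Sum>j\<in>?A. \<Sum>k\<in>?A. if k = j then g j * g k * measure_pmf.expectation ?H (\<lambda>h. ?c j h * ?c k h) else 0)"
    by (intro sum.cong refl) (auto simp: expectation_sign_mult)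
  \<comment> \<open>On the diagonal the product of the two collision indicators is a single
    one.\<close>
  also have "\<dots> = (\<Sum>j\<in>?A. (g j)\<^sup>2 * measure_pmf.expectation ?H (?c j))"
    by (auto simp: power2_eq_square simp flip: of_bool_conj intro!: sum.cong)
  also have "\<dots> \<le> (\<Sum>j\<in>?A. (g j)\<^sup>2 * (1 / real w))"
    by (intro sum_mono mult_left_mono expectation_collision_le) (use assms in auto)
  also have "\<dots> \<le> (\<Sum>j=1..n. (g j)\<^sup>2 * (1 / real w))"
    by (rule sum_mono2) auto
  finally show ?thesis
    by (simp add: sum_divide_distrib)
qed

section \<open>Mean error and threshold probability of a table\<close>

lemma expectation_table_row:
  assumes "l \<in> {1..k}"
  shows "measure_pmf.expectation (table_seed_pmf n k w) (\<lambda>S. f (S l)) =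
    (measure_pmf.expectation (row_pmf n w) f :: real)"
proof -
  have "map_pmf (\<lambda>S. S l) (table_seed_pmf n k w) = row_pmf n w"
    using assms unfolding table_seed_pmf_def by (subst Pi_pmf_component) auto
  then show ?thesis
    by (metis integral_map_pmf)
qed

lemma cs_estimate_eq_median:
  "cs_estimate n k S g i = median (map (\<lambda>l. row_estimate n g i (S l)) [1..<k + 1])"
  by (simp add: cs_estimate_def row_estimate_def cs_counter_def)


text \<open>For odd \<open>k\<close> the median is one of the row estimates, so its error is at most
  the sum of the errors of all rows. The inequality 2 |x| \<le> c x^2 + 1/c then passes to second
  moments; the free weight \<open>c\<close> takes the place of a square root and is fixed
  later.\<close>

lemma expectation_cs_estimate_error_le:
  assumes "odd k" "w \<ge> 1" "i \<in> {1..n}" "c > 0"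
  shows "measure_pmf.expectation (table_seed_pmf n k w) (\<lambda>S. \<bar>g i - cs_estimate n k S g i\<bar>)
    \<le> real k * ((c * ((\<Sum>j=1..n. (g j)\<^sup>2) / real w) + 1 / c) / 2)"
proof -
  let ?p = "table_seed_pmf n k w"
  have int: "integrable (measure_pmf ?p) f" for f :: "table_seed \<Rightarrow> real"
    by (intro integrable_measure_pmf_finite finite_table_seed_pmf assms)
  have amgm: "\<bar>x\<bar> \<le> (c * x\<^sup>2 + 1 / c) / 2" for x
  proof -
    have "0 \<le> (c * \<bar>x\<bar> - 1)\<^sup>2 / c"
      using assms by simp
    also have "\<dots> = c * x\<^sup>2 + 1 / c - 2 * \<bar>x\<bar>"
      using assms by (simp add: power2_eq_square field_simps abs_if)
    finally show ?thesis by simp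
  qed
  have "measure_pmf.expectation ?p (\<lambda>S. \<bar>g i - cs_estimate n k S g i\<bar>)
    \<le> measure_pmf.expectation ?p (\<lambda>S. \<Sum>l=1..k. (c * (row_estimate n g i (S l) - g i)\<^sup>2 + 1 / c) / 2)"
  proof (intro integral_mono int)
    fix S
    have "cs_estimate n k S g i \<in> set (map (\<lambda>l. row_estimate n g i (S l)) [1..<k + 1])"
      unfolding cs_estimate_eq_median by (rule median_in_set) (use assms odd_pos[OF assms(1)] in auto)
    then obtain l where "l \<in> set [1..<k + 1]" "cs_estimate n k S g i = row_estimate n g i (S l)"
      unfolding set_map by blast
    then have l: "l \<in> {1..k}" "cs_estimate n k S g i = row_estimate n g i (S l)"
      by (simp_all del: upt_Suc)
    have "\<bar>g i - cs_estimate n k S g i\<bar> \<le> (c * (row_estimate n g i (S l) - g i)\<^sup>2 + 1 / c) / 2"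
      using amgm[of "row_estimate n g i (S l) - g i"] by (simp add: l(2) abs_minus_commute)
    also have "\<dots> \<le> (\<Sum>l=1..k. (c * (row_estimate n g i (S l) - g i)\<^sup>2 + 1 / c) / 2)"
      by (rule member_le_sum[OF l(1)]) (use assms in auto)
    finally show "\<bar>g i - cs_estimate n k S g i\<bar> \<le> \<dots>" .
  qed
  also have "\<dots> = (\<Sum>l=1..k. measure_pmf.expectation ?p
      (\<lambda>S. (c * (row_estimate n g i (S l) - g i)\<^sup>2 + 1 / c) / 2))"
    by (intro Bochner_Integration.integral_sum int)
  also have "\<dots> \<le> (\<Sum>l=1..k. (c * ((\<Sum>j=1..n. (g j)\<^sup>2) / real w) + 1 / c) / 2)"
  proof (rule sum_mono)
    fix l assume "l \<in> {1..k}"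
    have "measure_pmf.expectation ?p (\<lambda>S. (c * (row_estimate n g i (S l) - g i)\<^sup>2 + 1 / c) / 2)
      = (c * measure_pmf.expectation ?p (\<lambda>S. (row_estimate n g i (S l) - g i)\<^sup>2) + 1 / c) / 2"
      by (simp add: Bochner_Integration.integral_add[OF int int])
    also have "measure_pmf.expectation ?p (\<lambda>S. (row_estimate n g i (S l) - g i)\<^sup>2)
      = measure_pmf.expectation (row_pmf n w) (\<lambda>r. (row_estimate n g i r - g i)\<^sup>2)"
      by (rule expectation_table_row) fact
    also have "(c * \<dots> + 1 / c) / 2 \<le> (c * ((\<Sum>j=1..n. (g j)\<^sup>2) / real w) + 1 / c) / 2"
      by (intro divide_right_mono add_right_mono mult_left_mono row_estimate_second_moment)
        (use assms in auto)
    finally show "measure_pmf.expectation ?p (\<lambda>S. (c * (row_estimate n g i (S l) - g i)\<^sup>2 + 1 / c) / 2)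
      \<le> (c * ((\<Sum>j=1..n. (g j)\<^sup>2) / real w) + 1 / c) / 2" .
  qed
  finally show ?thesis by simp
qed

text \<open>Chebyshev with a union bound over the rows: if the median reaches \<open>t\<close>, some
  row does, and the squared error of that row is at least \<open>(t - g i)\<^sup>2\<close>. The
  values \<open>1 + a\<close> and 1 match the factors 16 and 1 of
  \<open>of_bool_median_le_prod\<close> when \<open>a = 15\<close>.\<close>

lemma expectation_cs_estimate_ge_le:
  assumes "k \<ge> 1" "w \<ge> 1" "i \<in> {1..n}" "g i < t" "a \<ge> 0"
  shows "measure_pmf.expectation (table_seed_pmf n k w)
      (\<lambda>S. if t \<le> cs_estimate n k S g i then 1 + a else 1)
    \<le> 1 + a * (real k * ((\<Sum>j=1..n. (g j)\<^sup>2) / real w) / (t - g i)\<^sup>2)"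
proof -
  let ?p = "table_seed_pmf n k w"
  let ?d = "\<lambda>S l. (row_estimate n g i (S l) - g i)\<^sup>2 / (t - g i)\<^sup>2"
  have int: "integrable (measure_pmf ?p) f" for f :: "table_seed \<Rightarrow> real"
    by (intro integrable_measure_pmf_finite finite_table_seed_pmf assms)
  have "measure_pmf.expectation ?p (\<lambda>S. if t \<le> cs_estimate n k S g i then 1 + a else 1)
    \<le> measure_pmf.expectation ?p (\<lambda>S. 1 + a * (\<Sum>l=1..k. ?d S l))"
  proof (intro integral_mono int)
    fix S
    show "(if t \<le> cs_estimate n k S g i then 1 + a else 1) \<le> 1 + a * (\<Sum>l=1..k. ?d S l)"
    proof (cases "t \<le> cs_estimate n k S g i")
      case True
      then have "\<exists>x\<in>set (map (\<lambda>l. row_estimate n g i (S l)) [1..<k + 1]). t \<le> x"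
        using assms(1) by (intro median_ge_imp_ex) (auto simp: cs_estimate_eq_median)
      then obtain l where "l \<in> set [1..<k + 1]" "t \<le> row_estimate n g i (S l)"
        unfolding set_map by blast
      then have l: "l \<in> {1..k}" "t \<le> row_estimate n g i (S l)"
        by (simp_all del: upt_Suc)
      have "1 \<le> ?d S l"
        using assms(4) l(2) by (simp add: power_mono)
      also have "\<dots> \<le> (\<Sum>l=1..k. ?d S l)"
        by (rule member_le_sum[OF l(1)]) auto
      finally show ?thesis
        using True assms(5) mult_left_mono[of 1 "\<Sum>l=1..k. ?d S l" a] by simp
    qed (use assms in \<open>auto intro!: mult_nonneg_nonneg sum_nonneg\<close>)
  qed
  also have "\<dots> = 1 + a * (\<Sum>l=1..k. measure_pmf.expectation ?p (\<lambda>S. ?d S l))"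
    by (simp add: Bochner_Integration.integral_add[OF int int] Bochner_Integration.integral_sum[OF int])
  also have "\<dots> \<le> 1 + a * (\<Sum>l=1..k. (\<Sum>j=1..n. (g j)\<^sup>2) / real w / (t - g i)\<^sup>2)"
  proof (intro add_left_mono mult_left_mono sum_mono)
    fix l assume l: "l \<in> {1..k}"
    show "measure_pmf.expectation ?p (\<lambda>S. ?d S l) \<le> (\<Sum>j=1..n. (g j)\<^sup>2) / real w / (t - g i)\<^sup>2"
      using divide_right_mono[OF row_estimate_second_moment[OF assms(2,3), of g], of "(t - g i)\<^sup>2"]
      by (simp add: expectation_table_row[OF l, where f = "\<lambda>r. (row_estimate n g i r - g i)\<^sup>2"])
  qed (use assms in auto)
  finally show ?thesis by simp
qed

section \<open>The error at one light coordinate\<close>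

text \<open>The constant 45 is 15 times 3 rows: \<open>small\<close> makes the excess over 1 of each
  narrow factor at most 1 in expectation. Each of the \<open>T - 1\<close> narrow tables then
  contributes 2 against a prefactor of 1/4, hence the power of 1/2.\<close>

lemma expectation_algorithm_estimate_error_le:
  fixes heavy :: "nat \<Rightarrow> bool" and \<sigma> :: stream
  defines "g \<equiv> frequency (filter (\<lambda>(j, \<Delta>). \<not> heavy j) \<sigma>)"
  assumes i: "i \<in> {1..n}" "\<not> heavy i" and T: "T \<ge> 2" and B: "B div (12 * T) \<ge> 1"
    and c: "c > 0" and \<tau>: "g i < \<tau>"
    and small: "45 * ((\<Sum>j=1..n. (g j)\<^sup>2) / real (B div (12 * T))) \<le> (\<tau> - g i)\<^sup>2"
  shows "measure_pmf.expectation (algorithm_seed_pmf n B T)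
      (\<lambda>S. \<bar>g i - algorithm_estimate n T \<tau> heavy \<sigma> S i\<bar>)
    \<le> \<bar>g i\<bar> + (1/2) ^ (T - 1) * (3 * ((c * ((\<Sum>j=1..n. (g j)\<^sup>2) / real (B div 12)) + 1 / c) / 2))"
proof -
  let ?p = "algorithm_seed_pmf n B T"
  define q where "q = (\<lambda>j. table_seed_pmf n 3 (if j = T then B div 12 else B div (12 * T)))"
  \<comment> \<open>Factor \<open>j\<close> depends on table \<open>j\<close> alone, the error of
    the wide table being the factor at \<open>T\<close>, so the expectation of the product
    splits.\<close>
  define F where "F = (\<lambda>j S. if j = T then \<bar>g i - cs_estimate n 3 S g i\<bar>
    else if \<tau> \<le> cs_estimate n 3 S g i then 1 + 15 else (1::real))"
  define M where "M = 3 * ((c * ((\<Sum>j=1..n. (g j)\<^sup>2) / real (B div 12)) + 1 / c) / 2)"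
  have B12: "B div 12 \<ge> 1"
    using B by (metis div_mult2_eq div_le_dividend order_trans)
  have finq: "finite (set_pmf (q j))" for j
    unfolding q_def using B B12 by (auto intro!: finite_table_seed_pmf)
  have p: "?p = Pi_pmf {1..T} undefined q"
    by (simp add: algorithm_seed_pmf_def q_def)
  have int: "integrable (measure_pmf ?p) f" for f :: "(nat \<Rightarrow> table_seed) \<Rightarrow> real"
    unfolding p by (intro integrable_measure_pmf_finite finite_set_Pi_pmf finq) auto
  have Fnn: "F j S \<ge> 0" for j S
    by (simp add: F_def)
  have insert: "{1..T} = insert T {1..<T}"
    using T by auto
  have pointwise: "\<bar>g i - algorithm_estimate n T \<tau> heavy \<sigma> S i\<bar>
      \<le> \<bar>g i\<bar> + (1/4) ^ (T - 1) * (\<Prod>j\<in>{1..T}. F j (S j))" for S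
  proof -
    let ?est = "\<lambda>j. cs_estimate n 3 (S j) g i"
    have "(\<Prod>j\<in>{1..T}. F j (S j)) = \<bar>g i - ?est T\<bar> * (\<Prod>j\<in>{1..<T}. if \<tau> \<le> ?est j then 16 else 1)"
      unfolding insert by (auto simp: F_def intro!: prod.cong)
    moreover have le: "of_bool (\<tau> \<le> median (map ?est [1..<T])) \<le>
        (1/4) ^ (T - 1) * (\<Prod>j\<in>{1..<T}. if \<tau> \<le> ?est j then 16 else (1::real))"
      using of_bool_median_le_prod[of "[1..<T]" \<tau> ?est] T by simp
    ultimately have "of_bool (\<tau> \<le> median (map ?est [1..<T])) * \<bar>g i - ?est T\<bar> \<le>
        (1/4) ^ (T - 1) * (\<Prod>j\<in>{1..T}. F j (S j))"
      using mult_right_mono[OF le, of "\<bar>g i - ?est T\<bar>"] by (simp add: mult_ac)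
    \<comment> \<open>The output 0 costs \<open>\<bar>g i\<bar>\<close>; the wide estimate is output
      only when the median of the narrow ones reaches \<tau>.\<close>
    moreover have "\<bar>g i - algorithm_estimate n T \<tau> heavy \<sigma> S i\<bar>
        \<le> \<bar>g i\<bar> + of_bool (\<tau> \<le> median (map ?est [1..<T])) * \<bar>g i - ?est T\<bar>"
      using i by (simp add: algorithm_estimate_def Let_def g_def not_less)
    ultimately show ?thesis by linarith
  qed
  have T_factor: "measure_pmf.expectation (q T) (F T) \<le> M"
    using expectation_cs_estimate_error_le[OF _ B12 i(1) c, of 3 g]
    by (simp add: q_def F_def M_def)
  have factor: "measure_pmf.expectation (q j) (F j) \<le> 2" if "j \<in> {1..<T}" for j
  proof -
    have "measure_pmf.expectation (q j) (F j) \<le>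
        1 + 15 * (real 3 * ((\<Sum>j=1..n. (g j)\<^sup>2) / real (B div (12 * T))) / (\<tau> - g i)\<^sup>2)"
      using expectation_cs_estimate_ge_le[of 3 "B div (12 * T)" i n g \<tau> 15] B i \<tau> that
      by (simp add: q_def F_def)
    also have "\<dots> = 1 + 45 * ((\<Sum>j=1..n. (g j)\<^sup>2) / real (B div (12 * T))) / (\<tau> - g i)\<^sup>2"
      by simp
    also have "\<dots> \<le> 1 + 1"
      by (intro add_left_mono) (use small \<tau> in \<open>simp add: divide_le_eq_1 del: One_nat_def times_divide_eq_right\<close>)
    finally show ?thesis by simp
  qed
  have "measure_pmf.expectation ?p (\<lambda>S. \<bar>g i - algorithm_estimate n T \<tau> heavy \<sigma> S i\<bar>)
      \<le> measure_pmf.expectation ?p (\<lambda>S. \<bar>g i\<bar> + (1/4) ^ (T - 1) * (\<Prod>j\<in>{1..T}. F j (S j)))"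
    by (intro integral_mono int pointwise)
  also have "\<dots> = \<bar>g i\<bar> + (1/4) ^ (T - 1) * measure_pmf.expectation ?p (\<lambda>S. \<Prod>j\<in>{1..T}. F j (S j))"
    by (simp add: Bochner_Integration.integral_add[OF int int])
  also have "measure_pmf.expectation ?p (\<lambda>S. \<Prod>j\<in>{1..T}. F j (S j)) =
      (\<Prod>j\<in>{1..T}. measure_pmf.expectation (q j) (F j))"
    unfolding p by (intro expectation_prod_Pi_pmf integrable_measure_pmf_finite finq Fnn) auto
  also have "\<dots> = measure_pmf.expectation (q T) (F T) * (\<Prod>j\<in>{1..<T}. measure_pmf.expectation (q j) (F j))"
    unfolding insert by simp
  also have "\<dots> \<le> M * (\<Prod>j\<in>{1..<T}. 2)"
    by (intro mult_mono prod_mono conjI T_factor factor Bochner_Integration.integral_nonneg prod_nonneg Fnn)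
      (use c in \<open>auto simp: M_def intro!: divide_nonneg_nonneg sum_nonneg add_nonneg_nonneg mult_nonneg_nonneg\<close>)
  also have "\<bar>g i\<bar> + (1/4) ^ (T - 1) * \<dots> = \<bar>g i\<bar> + ((1/4) ^ (T - 1) * 2 ^ (T - 1)) * M"
    by simp
  also have "(1/4) ^ (T - 1) * 2 ^ (T - 1) = (1/2::real) ^ (T - 1)"
    by (simp flip: power_mult_distrib)
  finally show ?thesis
    by (simp add: M_def)
qed

section \<open>The Zipfian tail and the rounding of column counts\<close>

text \<open>Telescoping, as 1/(k+1)^2 \<le> 1/k - 1/(k+1). The induction carries the stronger bound
  with \<open>- 1 / real n\<close>.\<close>

lemma sum_inverse_squares_tail_le:
  assumes "m \<ge> 2"
  shows "(\<Sum>j=m..n. 1 / (real j)\<^sup>2) \<le> 1 / (real m - 1)"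
proof (cases "m \<le> n")
  case True
  have "(\<Sum>j=m..n. 1 / (real j)\<^sup>2) \<le> 1 / (real m - 1) - 1 / real n"
    using True
  proof (induction n rule: dec_induct)
    case base
    then show ?case using assms by (simp add: field_simps power2_eq_square)
  next
    case (step k)
    have "1 / (real (Suc k))\<^sup>2 \<le> 1 / real k - 1 / real (Suc k)"
    proof -
      have "1 / (real (Suc k))\<^sup>2 \<le> 1 / (real k * real (Suc k))"
        using step assms by (intro divide_left_mono) (auto simp: power2_eq_square)
      also have "\<dots> = 1 / real k - 1 / real (Suc k)"
        using step assms by (simp add: field_simps)
      finally show ?thesis .
    qed
    then show ?case using step by simp
  qed
  moreover have "0 \<le> 1 / real n"
    by simp
  ultimately show ?thesis
    by linarith
qed (use assms in auto)

text \<open>The quotient q is at least 1, so B < (q + 1) d \<le> 2 q d: rounding down costs at most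
  a factor 2.\<close>

lemma half_quotient_le_div:
  assumes "d > 0" "2 * d \<le> (B::nat)"
  shows "real B / (2 * real d) \<le> real (B div d)"
proof -
  have "1 \<le> B div d"
    using assms by (simp add: Suc_le_eq div_greater_zero_iff)
  then have *: "d \<le> B div d * d"
    by simp
  have "B < d + B div d * d"
    by (rule dividend_less_div_times[OF assms(1)])
  also have "\<dots> \<le> 2 * (B div d * d)"
    unfolding mult_2 by (rule add_right_mono[OF *])
  finally have "B \<le> 2 * (B div d * d)"
    by (rule less_imp_le)
  then have "real B \<le> 2 * (real (B div d) * real d)"
    by (metis of_nat_le_iff of_nat_mult of_nat_numeral)
  then show ?thesis
    using assms by (simp add: field_simps)
qed


section \<open>Choice of constants and summation over the coordinates\<close>

theorem theorem2:
  "\<exists>(c_T::real) (c_\<tau>::real) (C::real) (n\<^sub>0::nat). c_T > 0 \<and> c_\<tau> > 0 \<and> C > 0 \<and>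
     (\<forall>(n::nat) (B::nat) (\<sigma>::stream) (heavy::nat \<Rightarrow> bool).
        n \<ge> n\<^sub>0 \<longrightarrow> real B \<ge> ln (real n) \<longrightarrow>
        (\<forall>(i, \<Delta>)\<in>set \<sigma>. i \<in> {1..n}) \<longrightarrow>
        (\<forall>i\<in>{1..n}. frequency \<sigma> i = 1 / real i) \<longrightarrow>
        (\<forall>i\<in>{1..n}. heavy i \<longleftrightarrow> real i \<le> real B / 2) \<longrightarrow>
        (let T = nat \<lceil>c_T * ln (ln (real n))\<rceil>;
             \<tau> = c_\<tau> * ln (ln (real n)) / real B
         in measure_pmf.expectation (algorithm_seed_pmf n B T)
              (\<lambda>S. weighted_error n (frequency \<sigma>) (algorithm_estimate n T \<tau> heavy \<sigma> S))
            \<le> C / (real B * ln (real n))))"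
proof -
  \<comment> \<open>The witnesses are 2 for \<open>c_T\<close>, 1 for \<open>c_\<tau>\<close> and
    296 for \<open>C\<close>. With L = ln (ln n), the bound 51840 = 3 * 17280 serves the Chebyshev
    condition on the narrow tables. The second condition gives B \<ge> 24 T, since T \<le> 2 L + 1,
    so narrow tables have columns and rounding is harmless.\<close>
  have "eventually (\<lambda>n::nat. ln (ln (real n)) \<ge> 51840) at_top"
    by real_asymp
  moreover have "eventually (\<lambda>n::nat. ln (real n) \<ge> 24 * (2 * ln (ln (real n)) + 1)) at_top"
    by real_asymp
  ultimately have "eventually (\<lambda>n::nat. ln (ln (real n)) \<ge> 51840 \<and>
      ln (real n) \<ge> 24 * (2 * ln (ln (real n)) + 1)) at_top"
    by eventually_elim auto
  then obtain n\<^sub>0 where n\<^sub>0: "\<And>n. n \<ge> n\<^sub>0 \<Longrightarrow> ln (ln (real n)) \<ge> 51840"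
    "\<And>n. n \<ge> n\<^sub>0 \<Longrightarrow> ln (real n) \<ge> 24 * (2 * ln (ln (real n)) + 1)"
    unfolding eventually_at_top_linorder by auto
  have bound: "measure_pmf.expectation (algorithm_seed_pmf n B (nat \<lceil>2 * ln (ln (real n))\<rceil>))
      (\<lambda>S. weighted_error n (frequency \<sigma>)
        (algorithm_estimate n (nat \<lceil>2 * ln (ln (real n))\<rceil>) (ln (ln (real n)) / real B) heavy \<sigma> S))
      \<le> 296 / (real B * ln (real n))"
    if n: "n \<ge> n\<^sub>0" and B: "real B \<ge> ln (real n)"
      and freq: "\<And>i. i \<in> {1..n} \<Longrightarrow> frequency \<sigma> i = 1 / real i"
      and heavy: "\<And>i. i \<in> {1..n} \<Longrightarrow> heavy i \<longleftrightarrow> real i \<le> real B / 2"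
    for n B :: nat and \<sigma> :: stream and heavy :: "nat \<Rightarrow> bool"
  proof -
    define L where "L = ln (ln (real n))"
    define T where "T = nat \<lceil>2 * L\<rceil>"
    define \<tau> where "\<tau> = L / real B"
    define g where "g = frequency (filter (\<lambda>(j, \<Delta>). \<not> heavy j) \<sigma>)"
    define alg where "alg = algorithm_estimate n T \<tau> heavy \<sigma>"
    define N where "N = (\<Sum>i=1..n. frequency \<sigma> i)"
    define G where "G = (\<Sum>j=1..n. (g j)\<^sup>2)"
    define E where "E = (\<lambda>i. measure_pmf.expectation (algorithm_seed_pmf n B T)
      (\<lambda>S. \<bar>frequency \<sigma> i - alg S i\<bar>))"
    have L: "L \<ge> 51840" "ln (real n) \<ge> 24 * (2 * L + 1)"
      using n\<^sub>0[OF n] by (auto simp: L_def)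
    have ln_pos: "ln (real n) > 0"
      by (rule less_le_trans[OF _ L(2)]) (use L(1) in simp)
    then have "n > 0"
      by (cases "n = 0") auto
    have T: "2 * L \<le> real T" "real T \<le> 2 * L + 1"
      using L(1) unfolding T_def by linarith+
    have "24 * real T \<le> 24 * (2 * L + 1)"
      using T(2) by simp
    also have "\<dots> \<le> real B"
      using L(2) B by (rule order_trans)
    finally have "24 * real T \<le> real B" .
    then have BT: "24 * T \<le> B"
      by (metis of_nat_le_iff of_nat_mult of_nat_numeral)
    have T2: "T \<ge> 2" and Bpos: "real B > 0" and B8: "B \<ge> 8"
      using T L BT by linarith+
    have wide: "real B / 24 \<le> real (B div 12)"
      using half_quotient_le_div[of 12 B] BT T2 by simp
    have narrow: "real B / (24 * real T) \<le> real (B div (12 * T))"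
      using half_quotient_le_div[of "12 * T" B] BT T2 by simp
    have "real B / (24 * real T) > 0"
      using Bpos T2 by simp
    with narrow have narrow1: "B div (12 * T) \<ge> 1"
      by (metis One_nat_def Suc_leI less_le_trans of_nat_0_less_iff)
    have g: "g i = (if heavy i then 0 else 1 / real i)" if "i \<in> {1..n}" for i
      using freq[OF that] frequency_filter[of "\<lambda>j. \<not> heavy j" \<sigma> i] by (simp add: g_def)
    have g_bounds: "0 \<le> g i" "g i \<le> 2 / real B" if "i \<in> {1..n}" for i
      using that heavy[OF that] Bpos by (auto simp: g field_simps)
    have G: "G \<le> 4 / real B"
    proof -
      \<comment> \<open>The first light coordinate; \<open>m - 1\<close> is \<open>B div 2\<close>,
        which is at least B/4.\<close>
      define m where "m = Suc (B div 2)"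
      have "G = (\<Sum>j=1..n. if \<not> heavy j then 1 / (real j)\<^sup>2 else 0)"
        unfolding G_def by (intro sum.cong refl) (simp add: g power_divide)
      also have "\<dots> = (\<Sum>j\<in>{j \<in> {1..n}. \<not> heavy j}. 1 / (real j)\<^sup>2)"
        by (rule sum.inter_filter[symmetric]) simp
      also have "\<dots> \<le> (\<Sum>j=m..n. 1 / (real j)\<^sup>2)"
        by (rule sum_mono2) (auto simp: heavy m_def)
      also have "\<dots> \<le> 1 / (real m - 1)"
        using B8 by (intro sum_inverse_squares_tail_le) (simp add: m_def)
      also have "\<dots> \<le> 4 / real B"
        using half_quotient_le_div[of 2 B] B8 by (simp add: m_def field_simps)
      finally show ?thesis .
    qed
    have G0: "G \<ge> 0"
      by (simp add: G_def sum_nonneg)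
    have V_wide: "G / real (B div 12) \<le> 96 / (real B)\<^sup>2"
    proof -
      have "G / real (B div 12) \<le> (4 / real B) / (real B / 24)"
        using G G0 wide Bpos by (intro frac_le) auto
      then show ?thesis by (simp add: power2_eq_square)
    qed
    have V_narrow: "G / real (B div (12 * T)) \<le> 96 * real T / (real B)\<^sup>2"
    proof -
      have "G / real (B div (12 * T)) \<le> (4 / real B) / (real B / (24 * real T))"
        using G G0 narrow \<open>real B / (24 * real T) > 0\<close> by (intro frac_le) auto
      then show ?thesis by (simp add: power2_eq_square)
    qed
    \<comment> \<open>As T \<ge> 2 L and 2 ln 2 \<ge> 1, the power 2^T is at least exp L = ln n; the
      numerator 2 pays for the exponent \<open>T - 1\<close>.\<close>
    have halves: "(1/2) ^ (T - 1) \<le> 2 / ln (real n)"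
    proof -
      have "ln (real n) = exp L"
        using ln_pos by (simp add: L_def)
      also have "\<dots> \<le> exp (real T * ln 2)"
      proof -
        have "L * 1 \<le> L * (2 * ln 2)"
          using L(1) ln2_ge_two_thirds by (intro mult_left_mono) auto
        also have "\<dots> \<le> real T * ln 2"
          using T(1) mult_right_mono[of "2 * L" "real T" "ln 2"] by simp
        finally show ?thesis by simp
      qed
      also have "\<dots> = 2 ^ T"
        by (simp add: exp_of_nat_mult)
      also have "\<dots> = 2 * 2 ^ (T - 1)"
        using T2 by (metis One_nat_def Suc_pred less_le_trans pos2 power_Suc)
      finally show ?thesis
        using ln_pos by (simp add: field_simps power_one_over)
    qed
    have E_light: "E i \<le> 1 / real i + 292 / (real B * ln (real n))" if i: "i \<in> {1..n}" "\<not> heavy i" for i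
    proof -
      have gi: "g i = 1 / real i" "frequency \<sigma> i = g i"
        using g[OF i(1)] i freq by auto
      \<comment> \<open>A light frequency is at most 2/B, which is at most half of \<tau> = L/B
        because L \<ge> 4.\<close>
      have gap: "L / (2 * real B) \<le> \<tau> - g i"
        using g_bounds(2)[OF i(1)] L(1) Bpos by (simp add: \<tau>_def field_simps)
      have "45 * (G / real (B div (12 * T))) \<le> 45 * (96 * real T / (real B)\<^sup>2)"
        using V_narrow by simp
      \<comment> \<open>Clearing denominators leaves 45 * 96 * 4 * T = 17280 T \<le> L^2, and T
        \<le> 3 L.\<close>
      also have "\<dots> \<le> (L / (2 * real B))\<^sup>2"
      proof -
        have "17280 * real T \<le> 17280 * (3 * L)"
          using T L by simp
        also have "\<dots> \<le> L * L"
          using L(1) by (simp add: mult_right_mono)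
        finally show ?thesis
          using Bpos by (simp add: field_simps power2_eq_square)
      qed
      also have "\<dots> \<le> (\<tau> - g i)\<^sup>2"
        using gap L(1) Bpos by (intro power_mono) auto
      finally have small: "45 * (G / real (B div (12 * T))) \<le> (\<tau> - g i)\<^sup>2" .
      have "L / (2 * real B) > 0"
        using L(1) Bpos by simp
      with gap have "g i < \<tau>"
        by linarith
      \<comment> \<open>The weight \<open>c\<close> is taken to be B: the row variance is at most
        96/B^2, so both terms of the bound are of order 1/B, with total constant 3 * 97 / 2 \<le>
        146.\<close>
      then have "E i \<le> \<bar>g i\<bar> + (1/2) ^ (T - 1) * (3 * ((real B * (G / real (B div 12)) + 1 / real B) / 2))"
        unfolding E_def gi(2) alg_def G_def g_def
        by (intro expectation_algorithm_estimate_error_le i T2 narrow1 Bpos)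
          (use small in \<open>simp_all only: G_def g_def\<close>)
      also have "3 * ((real B * (G / real (B div 12)) + 1 / real B) / 2) \<le> 146 / real B"
      proof -
        have "real B * (G / real (B div 12)) \<le> real B * (96 / (real B)\<^sup>2)"
          using V_wide by (rule mult_left_mono) simp
        also have "\<dots> = 96 * (1 / real B)"
          by (simp add: power2_eq_square)
        finally have *: "real B * (G / real (B div 12)) \<le> 96 * (1 / real B)" .
        have "3 * ((x + y) / 2) \<le> 146 * y" if "x \<le> 96 * y" "y > 0" for x y :: real
          using that by simp
        from this[OF *] show ?thesis
          using Bpos by simp
      qed
      also have "\<bar>g i\<bar> + (1/2) ^ (T - 1) * (146 / real B) \<le> 1 / real i + 2 / ln (real n) * (146 / real B)"
        using gi(1) Bpos by (intro add_mono mult_right_mono halves) auto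
      finally show ?thesis
        by (simp add: mult.commute)
    qed
    have E_heavy: "E i = 0" if "i \<in> {1..n}" "heavy i" for i
      using that frequency_filter[of heavy \<sigma> i] by (simp add: E_def alg_def algorithm_estimate_def)
    have int: "integrable (measure_pmf (algorithm_seed_pmf n B T)) f" for f :: "(nat \<Rightarrow> table_seed) \<Rightarrow> real"
      unfolding algorithm_seed_pmf_def
      by (intro integrable_measure_pmf_finite finite_set_Pi_pmf finite_table_seed_pmf)
        (use narrow1 BT T2 in auto)
    have N: "N = harm n"
      unfolding N_def harm_def by (intro sum.cong refl) (simp add: freq inverse_eq_divide)
    have "ln (real n) \<le> ln (real n + 1)"
      using \<open>n > 0\<close> by simp
    then have N_ge: "N \<ge> ln (real n)"
      using harm_ge_ln[of n] unfolding N by (rule order_trans)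
    have "measure_pmf.expectation (algorithm_seed_pmf n B T) (\<lambda>S. weighted_error n (frequency \<sigma>) (alg S))
        = 1 / N * (\<Sum>i=1..n. frequency \<sigma> i * E i)"
      by (simp add: weighted_error_def N_def E_def Bochner_Integration.integral_sum[OF int])
    \<comment> \<open>Heavy coordinates have \<open>E i = 0\<close> and \<open>g i = 0\<close>. For
      light ones the summand 1/i of \<open>E_light\<close>, weighted by 1/i, is
      \<open>(g i)\<^sup>2\<close>. The weights of the remaining term add up to \<open>N\<close> and
      cancel.\<close>
    also have "\<dots> \<le> 1 / N * (\<Sum>i=1..n. (g i)\<^sup>2 + frequency \<sigma> i * (292 / (real B * ln (real n))))"
    proof (intro mult_left_mono sum_mono)
      fix i assume i: "i \<in> {1..n}"
      show "frequency \<sigma> i * E i \<le> (g i)\<^sup>2 + frequency \<sigma> i * (292 / (real B * ln (real n)))"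
      proof (cases "heavy i")
        case True
        then show ?thesis using i E_heavy g freq ln_pos by simp
      next
        case False
        then show ?thesis
          using mult_left_mono[OF E_light[OF i False], of "1 / real i"] i g[OF i] freq[OF i]
          by (simp add: power2_eq_square ring_distribs)
      qed
    qed (use N_ge ln_pos in auto)
    also have "\<dots> = G / N + 292 / (real B * ln (real n))"
    proof -
      have "(\<Sum>i=1..n. (g i)\<^sup>2 + frequency \<sigma> i * (292 / (real B * ln (real n))))
          = G + N * (292 / (real B * ln (real n)))"
        unfolding sum.distrib G_def N_def sum_distrib_right ..
      moreover have "N > 0"
        using N_ge ln_pos by (rule less_le_trans[rotated])
      ultimately show ?thesis
        by (simp add: distrib_left)
    qed
    \<comment> \<open>\<open>N\<close> is a harmonic number, hence at least ln n. The constants 4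
      and 292 add up to 296.\<close>
    also have "G / N \<le> (4 / real B) / ln (real n)"
      using G G0 N_ge ln_pos by (intro frac_le) auto
    finally show ?thesis
      unfolding alg_def T_def \<tau>_def L_def by (simp add: add_divide_distrib[symmetric])
  qed
  show ?thesis
    using bound by (intro exI[of _ "2::real"] exI[of _ "1::real"] exI[of _ "296::real"] exI[of _ n\<^sub>0])
      (simp add: Let_def)
qed

end
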